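(* Let $b,c$ be positive integers with $q=\gcd(b,c)$ and let $p>1$ be an integer. Let $\chi_1$ and $\chi_2$ be non-principal primitive Dirichlet characters of modulus $k$. If $(-1)^{p+1}\chi_1(-1)\chi_2(-1)=1$, then $$(p+1)\left(bc^{p}s_{p}(b,c:\chi_1,\chi_2)+cb^{p}s_{p}(c,b:\overline{\chi_2},\overline{\chi_1})\right)=\sum_{j=0}^{p+1}\binom{p+1}{j}b^{j}c^{p+1-j}B_{j,\overline{\chi_1}}B_{p+1-j,\chi_2}+pq^{p+1}k^{p-1}\sum_{h=1}^{k-1}\sum_{a=1}^{k-1}\chi_1(h)\overline{\chi_2}(a)\overline{B}_{p+1}\left(\frac{ca+bh}{qk}\right).$$
   Context: The Bernoulli polynomials $B_n(x)$ are defined by $\frac{te^{xt}}{e^t-1}=\sum_{n\ge0}B_n(x)\frac{t^n}{n!}$ ($|t|<2\pi$). The Bernoulli functions are $\overline{B}_n(x)=B_n(x-[x])$ for $n>1$, where $[x]$ is the largest integer $\le x$, and $\overline{B}_1(x)=x-[x]-1/2$ if $x\in\mathbb{R}\setminus\mathbb{Z}$, $\overline{B}_1(x)=0$ if $x\in\mathbb{Z}$. For a primitive Dirichlet character $\chi$ of modulus $k$, with $\overline{\chi}$ the complex conjugate character, the generalized Bernoulli polynomials $B_{n,\chi}(x)$ are defined by $\sum_{a=0}^{k-1}\frac{\overline{\chi}(a)te^{(a+x)t}}{e^{kt}-1}=\sum_{n\ge0}B_{n,\chi}(x)\frac{t^n}{n!}$ ($|t|<2\pi/k$) (note the conjugate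 on the left), and $B_{n,\chi}=B_{n,\chi}(0)$. For non-principal $\chi$, the generalized Bernoulli functions are $\overline{B}_{m,\chi}(x)=k^{m-1}\sum_{n=1}^{k-1}\overline{\chi}(n)\overline{B}_m\left(\frac{n+x}{k}\right)$ for $m\ge1$ and all real $x$; they have period $k$. For primitive characters $\chi_1,\chi_2$ of the same modulus $k$ and positive integers $b,c$, the character Dedekind sum is $$s_p(b,c:\chi_1,\chi_2)=\sum_{n=0}^{ck-1}\chi_1(n)\,\overline{B}_{p,\chi_2}\left(\frac{bn}{c}\right)\overline{B}_1\left(\frac{n}{ck}\right).$$ *)

theory Defs
  imports "HOL-Complex_Analysis.Complex_Analysis" "HOL-Number_Theory.Cong"
begin

text \<open>The generating functions below have a removable singularity at \<open>0\<close>.  They are rendered as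
  quotients of formal power series, the division cancelling the common factor \<open>fps_X\<close>; the lemmas
  \<open>bernoulli_poly_sums\<close> and \<open>gen_bernoulli_poly_sums\<close> give the corresponding convergent
  expansions.\<close>

definition bernoulli_poly :: "nat \<Rightarrow> 'a::field_char_0 \<Rightarrow> 'a" where
  "bernoulli_poly n x = fact n * fps_nth (fps_X * fps_exp x / (fps_exp 1 - 1)) n"

definition bernoulli_fun :: "nat \<Rightarrow> real \<Rightarrow> real" where
  "bernoulli_fun n x =
     (if n = 1 then (if x \<in> \<int> then 0 else x - of_int \<lfloor>x\<rfloor> - 1 / 2)
      else bernoulli_poly n (x - of_int \<lfloor>x\<rfloor>))"

text \<open>Characters of modulus \<open>k\<close> are extended by \<open>0\<close> to all integers, so that \<open>chi (- 1)\<close> makes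
  sense; \<open>chi 1 = 1\<close> follows from the conditions.\<close>

definition dirichlet_character :: "nat \<Rightarrow> (int \<Rightarrow> complex) \<Rightarrow> bool" where
  "dirichlet_character k chi \<longleftrightarrow> k > 0 \<and> (\<forall>a. chi (a + int k) = chi a) \<and>
     (\<forall>a b. chi (a * b) = chi a * chi b) \<and> (\<forall>a. chi a \<noteq> 0 \<longleftrightarrow> coprime a (int k))"

definition principal_character :: "nat \<Rightarrow> int \<Rightarrow> complex" where
  "principal_character k a = (if coprime a (int k) then 1 else 0)"

definition induced_modulus :: "nat \<Rightarrow> (int \<Rightarrow> complex) \<Rightarrow> nat \<Rightarrow> bool" where
  "induced_modulus k chi d \<longleftrightarrow> d dvd k \<and>
     (\<forall>a. coprime a (int k) \<longrightarrow> [a = 1] (mod int d) \<longrightarrow> chi a = 1)"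

definition primitive_character :: "nat \<Rightarrow> (int \<Rightarrow> complex) \<Rightarrow> bool" where
  "primitive_character k chi \<longleftrightarrow>
     dirichlet_character k chi \<and> (\<forall>d<k. \<not> induced_modulus k chi d)"

text \<open>Berndt's convention: the generalized Bernoulli polynomials and functions attached to \<open>chi\<close>
  are built from the conjugate of \<open>chi\<close>.\<close>

definition gen_bernoulli_poly :: "nat \<Rightarrow> (int \<Rightarrow> complex) \<Rightarrow> nat \<Rightarrow> complex \<Rightarrow> complex" where
  "gen_bernoulli_poly k chi n x = fact n *
     fps_nth (\<Sum>a<k. fps_const (cnj (chi (int a))) * fps_X * fps_exp (of_nat a + x) /
                     (fps_exp (of_nat k) - 1)) n"

definition gen_bernoulli_num :: "nat \<Rightarrow> (int \<Rightarrow> complex) \<Rightarrow> nat \<Rightarrow> complex" where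
  "gen_bernoulli_num k chi n = gen_bernoulli_poly k chi n 0"

text \<open>Only meant for \<open>m \<ge> 1\<close>.\<close>

definition gen_bernoulli_fun :: "nat \<Rightarrow> (int \<Rightarrow> complex) \<Rightarrow> nat \<Rightarrow> real \<Rightarrow> complex" where
  "gen_bernoulli_fun k chi m x = of_nat k ^ (m - 1) *
     (\<Sum>n=1..k-1. cnj (chi (int n)) * of_real (bernoulli_fun m ((real n + x) / real k)))"

definition char_dedekind_sum ::
    "nat \<Rightarrow> nat \<Rightarrow> nat \<Rightarrow> nat \<Rightarrow> (int \<Rightarrow> complex) \<Rightarrow> (int \<Rightarrow> complex) \<Rightarrow> complex" where
  "char_dedekind_sum k p b c chi\<^sub>1 chi\<^sub>2 =
     (\<Sum>n<c * k. chi\<^sub>1 (int n) * gen_bernoulli_fun k chi\<^sub>2 p (real b * real n / real c) *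
                of_real (bernoulli_fun 1 (real n / (real c * real k))))"

lemma subdegree_fps_exp_minus_one:
  fixes c :: "'a::field_char_0"
  assumes "c \<noteq> 0"
  shows "subdegree (fps_exp c - 1) = 1"
  using assms by (intro subdegreeI) auto

lemma fps_exp_quotient_sums:
  fixes c y t :: complex and k :: nat
  assumes k: "k > 0" and t: "t \<noteq> 0" "norm t < 2 * pi / k"
  shows "(\<lambda>n. fps_nth (fps_const c * fps_X * fps_exp y / (fps_exp (of_nat k) - 1)) n * t ^ n)
           sums (c * t * exp (y * t) / (exp (of_nat k * t) - 1))"
proof -
  let ?F = "fps_const c * fps_X * fps_exp y"
  let ?G = "fps_exp (of_nat k) - 1 :: complex fps"
  define R where "R = ereal (2 * pi / k)"
  have sub: "subdegree ?G = 1"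
    using k by (intro subdegree_fps_exp_minus_one) auto
  have nz: "?G \<noteq> 0"
    using sub by (metis subdegree_0 zero_neq_one)
  have F: "fps_conv_radius ?F = \<infinity>"
    using fps_conv_radius_mult[of "fps_const c * fps_X" "fps_exp y"]
      fps_conv_radius_mult[of "fps_const c" fps_X] by simp
  have G: "fps_conv_radius ?G = \<infinity>"
    using fps_conv_radius_diff[of "fps_exp (of_nat k :: complex)" 1] by simp
  have evG: "eval_fps ?G z = exp (of_nat k * z) - 1" for z
    by (subst eval_fps_diff) auto
  have cX: "fps_conv_radius (fps_const c * fps_X) = \<infinity>"
    using fps_conv_radius_mult[of "fps_const c" fps_X] by simp
  have evF: "eval_fps ?F z = c * z * exp (y * z)" for z
    by (subst eval_fps_mult; (subst eval_fps_mult)?; simp add: cX)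
  have ne: "eval_fps ?G z \<noteq> 0" if z: "z \<in> eball 0 R" "z \<noteq> 0" for z
  proof
    assume "eval_fps ?G z = 0"
    hence "exp (of_nat k * z) = 1"
      by (simp add: evG)
    then obtain n :: int where n: "Re (of_nat k * z) = 0" "Im (of_nat k * z) = of_int (2 * n) * pi"
      unfolding exp_eq_1 by blast
    have kz: "of_nat k * z = \<i> * of_real (of_int (2 * n) * pi)"
      using n by (simp add: complex_eq_iff)
    have "norm (of_nat k * z) < 2 * pi"
      using z k by (simp add: R_def norm_mult field_simps)
    moreover have "norm (of_nat k * z) = 2 * pi * \<bar>real_of_int n\<bar>"
      unfolding kz by (simp add: norm_mult abs_mult)
    ultimately have "\<bar>real_of_int n\<bar> < 1"
      by simp
    hence "n = 0"
      by linarith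
    thus False
      using kz z k by simp
  qed
  have R: "R > 0"
    using k by (simp add: R_def)
  have F0: "subdegree ?G \<le> subdegree ?F" if "?F \<noteq> 0"
    using that sub by (simp add: mult.commute)
  show ?thesis
  proof (cases "c = 0")
    case False
    have le: "subdegree ?G \<le> subdegree ?F"
      using False by (intro F0) simp
    have tR: "t \<in> eball 0 R"
      using t by (simp add: R_def)
    have "Min {R, fps_conv_radius ?F, fps_conv_radius ?G} \<le> fps_conv_radius (?F / ?G)"
      by (rule fps_conv_radius_divide) (use R ne le F G in auto)
    hence rad: "fps_conv_radius (?F / ?G) \<ge> R"
      unfolding F G by simp
    have "eval_fps (?F / ?G) t = (if t = 0 then fps_nth ?F (subdegree ?G) / fps_nth ?G (subdegree ?G)
            else eval_fps ?F t / eval_fps ?G t)"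
    proof (rule eval_fps_divide)
      show "ereal (norm t) < Min {R, fps_conv_radius ?F, fps_conv_radius ?G}"
        using tR unfolding F G by simp
    qed (use R ne le F G in auto)
    hence "eval_fps (?F / ?G) t = eval_fps ?F t / eval_fps ?G t"
      using t by simp
    moreover have "(\<lambda>n. fps_nth (?F / ?G) n * t ^ n) sums eval_fps (?F / ?G) t"
      using rad tR by (intro sums_eval_fps less_le_trans[OF _ rad]) simp
    ultimately show ?thesis
      by (simp add: evF evG)
  qed simp
qed

lemma bernoulli_poly_sums:
  fixes x t :: complex
  assumes "t \<noteq> 0" "norm t < 2 * pi"
  shows "(\<lambda>n. bernoulli_poly n x * t ^ n / fact n) sums (t * exp (x * t) / (exp t - 1))"
  using fps_exp_quotient_sums[of 1 t 1 x] assms by (simp add: bernoulli_poly_def)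

lemma of_real_bernoulli_poly:
  "complex_of_real (bernoulli_poly n x) = bernoulli_poly n (of_real x)"
proof -
  define H where "H = (\<lambda>f. Abs_fps (\<lambda>n. complex_of_real (fps_nth f n)))"
  have H_mult: "H (f * g) = H f * H g" for f g
    by (simp add: H_def fps_eq_iff fps_mult_nth)
  let ?D = "fps_exp 1 - 1 :: real fps" and ?D' = "fps_exp 1 - 1 :: complex fps"
  let ?N = "fps_X * fps_exp x" and ?N' = "fps_X * fps_exp (complex_of_real x)"
  have sub: "subdegree ?D = 1" "subdegree ?D' = 1"
    by (rule subdegree_fps_exp_minus_one; simp)+
  have nz: "?D \<noteq> 0" "?D' \<noteq> 0"
    using sub by (metis subdegree_0 zero_neq_one)+
  have "?D dvd ?N"
    using sub nz by (subst fps_dvd_iff) (auto simp del: right_minus_eq)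
  hence "?N / ?D * ?D = ?N"
    by simp
  hence "H (?N / ?D) * H ?D = H ?N"
    by (metis H_mult)
  moreover have "H ?D = ?D'"
    by (auto simp: H_def fps_eq_iff)
  moreover have "H ?N = ?N'"
    by (auto simp: H_def fps_eq_iff)
  ultimately have "H (?N / ?D) = ?N' / ?D'"
    using nz by (metis nonzero_mult_div_cancel_right)
  hence "complex_of_real (fps_nth (?N / ?D) n) = fps_nth (?N' / ?D') n"
    by (simp add: H_def fps_eq_iff)
  thus ?thesis
    by (simp add: bernoulli_poly_def)
qed

lemma gen_bernoulli_poly_sums:
  fixes x t :: complex
  assumes "k > 0" "t \<noteq> 0" "norm t < 2 * pi / k"
  shows "(\<lambda>n. gen_bernoulli_poly k chi n x * t ^ n / fact n) sums
           (\<Sum>a<k. cnj (chi (int a)) * t * exp ((of_nat a + x) * t) / (exp (of_nat k * t) - 1))"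
proof -
  let ?f = "\<lambda>a. fps_const (cnj (chi (int a))) * fps_X * fps_exp (of_nat a + x) /
                  (fps_exp (of_nat k) - 1)"
  have "(\<lambda>n. \<Sum>a<k. fps_nth (?f a) n * t ^ n) sums
          (\<Sum>a<k. cnj (chi (int a)) * t * exp ((of_nat a + x) * t) / (exp (of_nat k * t) - 1))"
    using assms by (intro sums_sum fps_exp_quotient_sums)
  also have "(\<lambda>n. \<Sum>a<k. fps_nth (?f a) n * t ^ n) =
               (\<lambda>n. gen_bernoulli_poly k chi n x * t ^ n / fact n)"
    by (simp add: gen_bernoulli_poly_def fps_sum_nth sum_distrib_right)
  finally show ?thesis .
qed

end

theory Submission
  imports Defs
begin

text \<open>
  Splitting the summation index of the character Dedekind sum as \<open>n = h + m k\<close> turns both sums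
  into \<open>k\<^sup>p\<^sup>-\<^sup>1\<close> times sums, with the same weights \<open>\<chi>\<^sub>1(h)\<close> times the conjugate of \<open>\<chi>\<^sub>2(a)\<close>, of Dedekind sums
  without characters but with shifts \<open>x = h/k\<close> and \<open>y = a/k\<close> in \<open>(0,1)\<close>
  (\<open>char_dedekind_sum_eq\<close>).  It is therefore enough to prove a reciprocity law for each pair of
  shifts, \<open>shifted_dedekind_sum_reciprocity\<close>, and to sum it with these weights.

  That law is first proved for \<open>b = c = 1\<close>, where it is a pointwise identity for \<open>u, v\<close> in \<open>(0,1)\<close>
  (\<open>bernoulli_fun_convolution\<close>).  The identity expresses the fact that the product of the generating
  functions \<open>t exp(ut)/(exp t - 1)\<close> and \<open>t exp(vt)/(exp t - 1)\<close> is
  \<open>F + z t F - t F'\<close>, where \<open>z = u + v - 1\<close> and \<open>F = t exp(zt)/(exp t - 1)\<close>.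

  The general case follows by summing the pointwise identity over \<open>u = (x + m)/c\<close>, \<open>m < c\<close>, and
  \<open>v = (y + l)/b\<close>, \<open>l < b\<close>.  Every sum over \<open>m\<close> or \<open>l\<close> that is not part of a Dedekind sum is
  evaluated by the multiplication theorem for Bernoulli polynomials and functions
  (\<open>bernoulli_poly_multiplication\<close>, \<open>bernoulli_fun_multiplication\<close>).  The greatest common divisor
  enters through the double sum of the function of order \<open>p + 1\<close>: the numbers \<open>m/c + l/b\<close> cover the
  multiples of \<open>q/(b c)\<close> modulo 1, each \<open>q\<close> times.
\<close>

section \<open>The generating function of the Bernoulli polynomials\<close>

text \<open>The exponential generating function \<open>t exp(xt)/(exp t - 1)\<close> of the Bernoulli polynomials at \<open>x\<close>.\<close>

definition bernoulli_fps :: "'a::field_char_0 \<Rightarrow> 'a fps" where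
  "bernoulli_fps x = fps_X * fps_exp x / (fps_exp 1 - 1)"

lemma bernoulli_poly_eq_fps_nth: "bernoulli_poly n x = fact n * fps_nth (bernoulli_fps x) n"
  by (simp add: bernoulli_poly_def bernoulli_fps_def)

lemma fps_exp_minus_one_nonzero:
  fixes c :: "'a::field_char_0"
  assumes "c \<noteq> 0"
  shows "fps_exp c - 1 \<noteq> 0"
  using subdegree_fps_exp_minus_one[OF assms] by (metis subdegree_0 zero_neq_one)

lemma fps_X_exp_divide_times:
  fixes c d x :: "'a::field_char_0"
  assumes "c \<noteq> 0"
  shows "fps_const d * fps_X * fps_exp x / (fps_exp c - 1) * (fps_exp c - 1) =
           fps_const d * fps_X * fps_exp x"
proof (cases "d = 0")
  case False
  have "fps_exp c - 1 dvd fps_const d * fps_X * fps_exp x"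
    using subdegree_fps_exp_minus_one[OF assms] fps_exp_minus_one_nonzero[OF assms] False
    by (subst fps_dvd_iff) (auto simp del: right_minus_eq simp: mult.commute)
  thus ?thesis by simp
qed simp

lemma bernoulli_fps_times: "bernoulli_fps x * (fps_exp 1 - 1) = fps_X * fps_exp x"
  using fps_X_exp_divide_times[of 1 1 x] by (simp add: bernoulli_fps_def)

text \<open>
  Rescaling \<open>t\<close> to \<open>c t\<close>.  It serves for \<open>c = 1/N\<close> in the multiplication theorem and for \<open>c = k\<close> in
  the generalized Bernoulli numbers.
\<close>

lemma bernoulli_fps_compose_linear:
  fixes c x :: "'a::field_char_0"
  shows "(bernoulli_fps x oo (fps_const c * fps_X)) * (fps_exp c - 1) =
           fps_const c * fps_X * fps_exp (x * c)"
proof -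
  have "(bernoulli_fps x oo (fps_const c * fps_X)) * ((fps_exp 1 - 1) oo (fps_const c * fps_X))
          = (fps_X * fps_exp x) oo (fps_const c * fps_X)"
    by (subst fps_compose_mult_distrib[symmetric]) (simp_all add: bernoulli_fps_times)
  thus ?thesis
    by (simp add: fps_compose_mult_distrib fps_compose_sub_distrib)
qed

text \<open>
  Writing \<open>F = t e\<^sup>z\<^sup>t/(e\<^sup>t - 1)\<close>, the right-hand side is \<open>F + z t F - t F'\<close>.  Differentiating
  \<open>F (e\<^sup>t - 1) = t e\<^sup>z\<^sup>t\<close> produces a term \<open>F e\<^sup>t\<close>, and \<open>t F e\<^sup>t/(e\<^sup>t - 1)\<close> is the product on the left,
  because \<open>x + y = z + 1\<close>.
\<close>

lemma bernoulli_fps_mult: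
  fixes x y z :: "'a::field_char_0"
  assumes "x + y = z + 1"
  shows "bernoulli_fps x * bernoulli_fps y =
           bernoulli_fps z + fps_const z * fps_X * bernoulli_fps z
             - fps_X * fps_deriv (bernoulli_fps z)"
proof -
  let ?E = "fps_exp (1::'a)" and ?F = "bernoulli_fps z"
  have nz: "?E - 1 \<noteq> 0"
    by (rule fps_exp_minus_one_nonzero) simp
  have "fps_deriv (?F * (?E - 1)) = fps_deriv (fps_X * fps_exp z)"
    by (simp add: bernoulli_fps_times)
  hence D: "fps_deriv ?F * (?E - 1) + ?F * ?E = fps_exp z + fps_X * fps_const z * fps_exp z"
    by (simp add: algebra_simps)
  have X: "?F * (?E - 1) = fps_X * fps_exp z"
    by (rule bernoulli_fps_times)
  have "(bernoulli_fps x * bernoulli_fps y) * (?E - 1) * (?E - 1)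
          = (bernoulli_fps x * (?E - 1)) * (bernoulli_fps y * (?E - 1))"
    by (simp only: mult_ac)
  also have "\<dots> = fps_X * fps_X * (fps_exp x * fps_exp y)"
    unfolding bernoulli_fps_times by (simp only: mult_ac)
  also have "fps_exp x * fps_exp y = fps_exp z * ?E"
    by (simp add: fps_exp_add_mult[symmetric] assms)
  also have "fps_X * fps_X * (fps_exp z * ?E) = fps_X * ?E * (fps_X * fps_exp z)"
    by (simp only: mult_ac)
  also have "\<dots> = fps_X * (?F * ?E) * (?E - 1)"
    unfolding X[symmetric] by (simp only: mult_ac)
  also have "?F * ?E = fps_exp z + fps_X * fps_const z * fps_exp z - fps_deriv ?F * (?E - 1)"
    using D by (simp add: algebra_simps)
  also have "fps_X * (fps_exp z + fps_X * fps_const z * fps_exp z - fps_deriv ?F * (?E - 1))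
      = fps_X * fps_exp z + fps_const z * fps_X * (fps_X * fps_exp z)
          - fps_X * fps_deriv ?F * (?E - 1)"
    by (simp add: algebra_simps)
  also have "\<dots> = (?F + fps_const z * fps_X * ?F - fps_X * fps_deriv ?F) * (?E - 1)"
    unfolding X[symmetric] by (simp only: algebra_simps)
  finally show ?thesis
    using nz by (metis mult_right_cancel)
qed

lemma bernoulli_fps_one: "bernoulli_fps (x + 1) = bernoulli_fps x + fps_X * fps_exp x"
proof -
  have "bernoulli_fps (x + 1) * (fps_exp 1 - 1)
      = (bernoulli_fps x + fps_X * fps_exp x) * (fps_exp 1 - 1)"
    unfolding distrib_right bernoulli_fps_times by (simp add: fps_exp_add_mult algebra_simps)
  thus ?thesis
    using fps_exp_minus_one_nonzero[of "1::'a"] by (metis mult_right_cancel one_neq_zero)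
qed

lemma bernoulli_poly_add_one:
  "bernoulli_poly (Suc n) (x + 1) = bernoulli_poly (Suc n) x + of_nat (Suc n) * x ^ n"
  unfolding bernoulli_poly_eq_fps_nth bernoulli_fps_one by (simp add: field_simps)

lemma bernoulli_poly_convolution:
  fixes x y z :: "'a::field_char_0"
  assumes "x + y = z + 1"
  shows "(\<Sum>j=0..Suc n. of_nat (Suc n choose j) * bernoulli_poly j x * bernoulli_poly (Suc n - j) y)
           = of_nat (Suc n) * z * bernoulli_poly n z - of_nat n * bernoulli_poly (Suc n) z"
proof -
  have "fact (Suc n) * fps_nth (bernoulli_fps x * bernoulli_fps y) (Suc n) =
      of_nat (Suc n) * z * bernoulli_poly n z - of_nat n * bernoulli_poly (Suc n) z"
    unfolding bernoulli_fps_mult[OF assms]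
    by (simp add: bernoulli_poly_eq_fps_nth algebra_simps)
  moreover have "fact (Suc n) * fps_nth (bernoulli_fps x * bernoulli_fps y) (Suc n) =
     (\<Sum>j=0..Suc n. of_nat (Suc n choose j) * bernoulli_poly j x * bernoulli_poly (Suc n - j) y)"
    unfolding fps_mult_nth sum_distrib_left
    by (intro sum.cong refl)
       (simp add: bernoulli_poly_eq_fps_nth binomial_fact del: fact_Suc)
  ultimately show ?thesis by simp
qed

text \<open>
  Raabe's multiplication theorem, without negative exponents so that no case distinction on \<open>n\<close> is
  needed.  It comes from \<open>exp t - 1 = (exp (t/N) - 1) (\<Sum>l<N. exp (l t/N))\<close>.
\<close>

lemma bernoulli_poly_multiplication:
  fixes x :: "'a::field_char_0"
  assumes N: "N > 0"
  shows "of_nat N ^ n * (\<Sum>l<N. bernoulli_poly n (x + of_nat l / of_nat N)) =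
           of_nat N * bernoulli_poly n (of_nat N * x)"
proof -
  let ?E = "fps_exp (1::'a) - 1" and ?d = "1 / of_nat N :: 'a"
  let ?e = "fps_exp ?d"
  have pow: "fps_exp (of_nat l / of_nat N) = ?e ^ l" for l
    by (simp add: fps_exp_power_mult)
  have geo: "(?e - 1) * (\<Sum>l<N. ?e ^ l) = ?E"
    unfolding power_diff_1_eq[symmetric] using N by (simp add: fps_exp_power_mult)
  have "(\<Sum>l<N. bernoulli_fps (x + of_nat l / of_nat N)) * ?E =
          fps_X * fps_exp x * (\<Sum>l<N. ?e ^ l)"
    unfolding sum_distrib_right bernoulli_fps_times
    by (simp add: fps_exp_add_mult pow sum_distrib_left mult_ac)
  also have "\<dots> = fps_const (of_nat N) *
      ((fps_const ?d * fps_X * fps_exp (of_nat N * x * ?d)) * (\<Sum>l<N. ?e ^ l))"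
    using N by (simp add: mult.assoc[symmetric])
  also have "\<dots> = fps_const (of_nat N) *
      (bernoulli_fps (of_nat N * x) oo (fps_const ?d * fps_X)) * ((?e - 1) * (\<Sum>l<N. ?e ^ l))"
    unfolding bernoulli_fps_compose_linear[symmetric] by (simp only: mult_ac)
  finally have "(\<Sum>l<N. bernoulli_fps (x + of_nat l / of_nat N)) =
      fps_const (of_nat N) * (bernoulli_fps (of_nat N * x) oo (fps_const ?d * fps_X))"
    using fps_exp_minus_one_nonzero[of "1::'a"] unfolding geo
    by (metis mult_right_cancel one_neq_zero)
  hence "fps_nth (\<Sum>l<N. bernoulli_fps (x + of_nat l / of_nat N)) n =
     of_nat N * (?d ^ n * fps_nth (bernoulli_fps (of_nat N * x)) n)"
    by (simp add: fps_compose_linear)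
  thus ?thesis
    using N by (simp add: bernoulli_poly_eq_fps_nth sum_distrib_left[symmetric] fps_sum_nth field_simps)
qed

section \<open>Bernoulli functions\<close>

lemma bernoulli_fun_eq_frac: "n \<noteq> 1 \<Longrightarrow> bernoulli_fun n x = bernoulli_poly n (frac x)"
  by (simp add: bernoulli_fun_def frac_def)

lemma bernoulli_fun_add_int: "bernoulli_fun n (x + of_int i) = bernoulli_fun n x"
  by (simp add: bernoulli_fun_def)

lemma sum_affine_residues:
  fixes g :: "int \<Rightarrow> 'a::comm_monoid_add"
  assumes N: "N > 0" and a: "coprime a (int N)" and per: "\<And>i. g (i + int N) = g i"
  shows "(\<Sum>l<N. g (a * int l + s)) = (\<Sum>l<N. g (int l))"
proof -
  have per': "g (i + j * int N) = g i" for i j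
  proof (induction j rule: int_induct[where k = 0])
    case (step1 j)
    thus ?case using per[of "i + j * int N"] by (simp add: algebra_simps)
  next
    case (step2 j)
    thus ?case using per[of "i + (j - 1) * int N"] by (simp add: algebra_simps)
  qed simp
  have md: "g (i mod int N) = g i" for i
    using per'[of "i mod int N" "i div int N"] by (simp add: mod_div_mult_eq)
  let ?h = "\<lambda>l. nat ((a * int l + s) mod int N)"
  have inj: "inj_on ?h {..<N}"
  proof (rule inj_onI)
    fix l m assume lm: "l \<in> {..<N}" "m \<in> {..<N}" "?h l = ?h m"
    hence "[a * int l + s = a * int m + s] (mod int N)"
      using N by (simp add: cong_def eq_nat_nat_iff)
    hence "[int l = int m] (mod int N)"
      using a by (simp add: cong_add_rcancel cong_mult_lcancel)
    thus "l = m"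
      using lm by (simp add: cong_int_iff cong_def)
  qed
  have "?h ` {..<N} \<subseteq> {..<N}"
    using N by (auto simp: nat_less_iff)
  hence bij: "bij_betw ?h {..<N} {..<N}"
    using inj by (simp add: bij_betw_def endo_inj_surj)
  have "(\<Sum>l<N. g (a * int l + s)) = (\<Sum>l<N. g (int (?h l)))"
    using N by (simp add: md)
  also have "\<dots> = (\<Sum>l<N. g (int l))"
    by (rule sum.reindex_bij_betw[OF bij])
  finally show ?thesis .
qed

text \<open>
  Raabe's theorem for Bernoulli functions.  By periodicity the steps \<open>1/N\<close> may be replaced by
  \<open>a/N\<close> with \<open>a\<close> coprime to \<open>N\<close>.  The order 1 is excluded because the function of order 1 is
  redefined at the integers.
\<close>

lemma bernoulli_fun_multiplication:
  assumes N: "N > 0" and a: "coprime a N" and n: "n \<noteq> 1"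
  shows "real N ^ n * (\<Sum>l<N. bernoulli_fun n (x + real a * real l / real N)) =
           real N * bernoulli_fun n (real N * x)"
proof -
  define s where "s = \<lfloor>real N * x\<rfloor>"
  define w where "w = frac (real N * x)"
  have x: "x = (w + of_int s) / real N"
    using N by (simp add: w_def s_def frac_def)
  have w: "0 \<le> w" "w < 1"
    by (simp_all add: w_def frac_lt_1)
  \<comment> \<open>The function \<open>?g\<close> on the integers has period \<open>N\<close>; the integer part \<open>s\<close> only permutes residues.\<close>
  let ?g = "\<lambda>i. bernoulli_fun n (w / real N + of_int i / real N)"
  have "(\<Sum>l<N. bernoulli_fun n (x + real a * real l / real N)) = (\<Sum>l<N. ?g (int a * int l + s))"
    by (simp add: x add_divide_distrib add_ac)
  also have "\<dots> = (\<Sum>l<N. ?g (int l))"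
  proof (rule sum_affine_residues)
    show "?g (i + int N) = ?g i" for i
      using N bernoulli_fun_add_int[of n "w / real N + of_int i / real N" 1]
      by (simp add: add_divide_distrib add_ac)
  qed (use N a in auto)
  also have "\<dots> = (\<Sum>l<N. bernoulli_poly n (w / real N + real l / real N))"
  proof (intro sum.cong refl)
    fix l assume "l \<in> {..<N}"
    hence "real l + 1 \<le> real N" by simp
    hence "frac (w / real N + real l / real N) = w / real N + real l / real N"
      using w N by (subst frac_eq) (auto simp: field_simps)
    thus "?g (int l) = bernoulli_poly n (w / real N + real l / real N)"
      using n by (simp add: bernoulli_fun_eq_frac)
  qed
  finally show ?thesis
    using bernoulli_poly_multiplication[OF N, of n "w / real N"] N n
    by (simp add: bernoulli_fun_eq_frac w_def)
qed

text \<open>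
  The reciprocity law for \<open>b = c = 1\<close>.  The two first-order values add up to \<open>z = u + v - 1\<close>.  The
  fractional part of \<open>u + v\<close> is \<open>z + 1\<close> or \<open>z\<close>; in the first case the difference equation
  \<open>bernoulli_poly_add_one\<close> changes both sides by the same multiple of \<open>z\<^sup>p\<close>.
\<close>

lemma bernoulli_fun_convolution:
  assumes u: "0 < u" "u < 1" and v: "0 < v" "v < 1" and p: "p > 1"
  shows "real (p + 1) * (bernoulli_fun p (u + v) * (bernoulli_fun 1 u + bernoulli_fun 1 v)) =
     (\<Sum>j=0..p+1. real ((p + 1) choose j) * bernoulli_poly j u * bernoulli_poly (p + 1 - j) v)
       + real p * bernoulli_fun (p + 1) (u + v)"
proof -
  define z where "z = u + v - 1"
  have conv: "(\<Sum>j=0..p+1. real ((p + 1) choose j) * bernoulli_poly j u * bernoulli_poly (p + 1 - j) v)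
      = real (p + 1) * z * bernoulli_poly p z - real p * bernoulli_poly (p + 1) z"
    using bernoulli_poly_convolution[of u v z p] by (simp add: z_def)
  have "bernoulli_fun 1 t = t - 1 / 2" if "0 < t" "t < 1" for t
  proof -
    have "frac t = t" using that by (simp add: frac_eq)
    moreover have "t \<notin> \<int>" using that by (auto elim!: Ints_cases)
    ultimately show ?thesis by (simp add: bernoulli_fun_def frac_def)
  qed
  hence B1: "bernoulli_fun 1 u + bernoulli_fun 1 v = z"
    using u v by (simp add: z_def)
  show ?thesis
  proof (cases "u + v < 1")
    case True
    hence fr: "frac (u + v) = z + 1"
      using u v by (simp add: z_def frac_eq)
    obtain r where r: "p = Suc r"
      using p by (cases p) auto
    have "bernoulli_fun (p + 1) (u + v) = bernoulli_poly (p + 1) z + real (p + 1) * z ^ p"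
      using p bernoulli_poly_add_one[of p z] by (simp add: bernoulli_fun_eq_frac fr)
    moreover have "bernoulli_fun p (u + v) = bernoulli_poly p z + real p * z ^ r"
      using p bernoulli_poly_add_one[of r z] by (simp add: bernoulli_fun_eq_frac fr r)
    moreover have "z ^ p = z * z ^ r"
      by (simp add: r)
    ultimately show ?thesis
      unfolding conv B1 by (simp add: algebra_simps)
  next
    case False
    hence "frac (u + v) = z"
      using u v frac_unique_iff[of "u + v" z] by (simp add: z_def)
    thus ?thesis
      unfolding conv B1 using p by (simp add: bernoulli_fun_eq_frac algebra_simps)
  qed
qed

section \<open>Reciprocity for Dedekind sums with shifts\<close>

text \<open>
  The Dedekind sum of order \<open>p\<close> with real shifts \<open>x\<close> and \<open>y\<close>.  The first shift is that of the
  summation variable and occurs in both factors.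
\<close>

definition shifted_dedekind_sum :: "nat \<Rightarrow> nat \<Rightarrow> nat \<Rightarrow> real \<Rightarrow> real \<Rightarrow> real" where
  "shifted_dedekind_sum p b c x y =
     (\<Sum>m<c. bernoulli_fun p (real b * ((x + real m) / real c) + y) *
              bernoulli_fun 1 ((x + real m) / real c))"

text \<open>
  With \<open>b = b' q\<close> and \<open>c = c' q\<close>, summing over \<open>m\<close> leaves a function of \<open>l\<close> with period \<open>b'\<close>, hence
  \<open>q\<close> equal sums over \<open>l < b'\<close>, with step \<open>c'/b'\<close> where \<open>c'\<close> is coprime to \<open>b'\<close>.
\<close>

lemma bernoulli_fun_sum_two_progressions:
  fixes b c n :: nat and z :: real
  assumes b: "b > 0" and c: "c > 0" and n: "n \<noteq> 1"
  defines "q \<equiv> gcd b c"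
  shows "real b ^ n * real c ^ n *
           (\<Sum>m<c. \<Sum>l<b. bernoulli_fun n (z / (real b * real c) + real m / real c + real l / real b))
         = real b * real c * real q ^ n * bernoulli_fun n (z / real q)"
proof -
  obtain b' c' where bc: "b = b' * q" "c = c' * q" "coprime b' c'"
    unfolding q_def using b gcd_coprime_exists[of b c] by auto
  have q: "q > 0" and b': "b' > 0" and c': "c' > 0"
    using b c bc by auto
  let ?f = "bernoulli_fun n"
  let ?g = "\<lambda>l. ?f (z / real b + real c' * real l / real b')"
  have g_per: "?g (l + i * b') = ?g l" for i l
  proof -
    have "real c' * real (l + i * b') / real b' = real c' * real l / real b' + of_int (int (c' * i))"
      using b' by (simp add: field_simps)
    thus ?thesis
      using bernoulli_fun_add_int[of n "z / real b + real c' * real l / real b'" "int (c' * i)"]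
      by (simp only: add.assoc)
  qed
  have "real c ^ n * (\<Sum>m<c. \<Sum>l<b. ?f (z / (real b * real c) + real m / real c + real l / real b))
      = (\<Sum>l<b. real c ^ n * (\<Sum>m<c. ?f ((z / (real b * real c) + real l / real b) + real m / real c)))"
    by (subst sum.swap) (simp add: sum_distrib_left add_ac)
  also have "\<dots> = (\<Sum>l<b. real c * ?g l)"
  proof (intro sum.cong refl)
    fix l
    have "real c * (z / (real b * real c) + real l / real b) = z / real b + real c' * real l / real b'"
      using b' c' q by (simp add: bc field_simps)
    thus "real c ^ n * (\<Sum>m<c. ?f ((z / (real b * real c) + real l / real b) + real m / real c))
            = real c * ?g l"
      using bernoulli_fun_multiplication[OF c, of 1 n "z / (real b * real c) + real l / real b"] n
      by simp
  qed
  also have "\<dots> = real c * (\<Sum>i<q. \<Sum>l\<in>{i * b'..<i * b' + b'}. ?g l)"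
    by (simp add: sum.nat_group sum_distrib_left[symmetric] bc(1) mult.commute)
  also have "(\<Sum>i<q. \<Sum>l\<in>{i * b'..<i * b' + b'}. ?g l) = (\<Sum>i<q. \<Sum>l<b'. ?g l)"
  proof (rule sum.cong[OF refl])
    fix i
    show "(\<Sum>l\<in>{i * b'..<i * b' + b'}. ?g l) = (\<Sum>l<b'. ?g l)"
      using sum.shift_bounds_nat_ivl[of ?g 0 "i * b'" b']
      unfolding add.commute[of "i * b'" b'] lessThan_atLeast0 by (simp only: add_0 g_per)
  qed
  finally have "real b ^ n * real c ^ n *
       (\<Sum>m<c. \<Sum>l<b. ?f (z / (real b * real c) + real m / real c + real l / real b))
     = real c * real q * real q ^ n * (real b' ^ n * (\<Sum>l<b'. ?g l))"
    by (simp add: bc(1) power_mult_distrib)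
  also have "real b' ^ n * (\<Sum>l<b'. ?g l) = real b' * ?f (real b' * (z / real b))"
    using bernoulli_fun_multiplication[of b' c' n "z / real b"] b' bc(3) n
    by (simp add: coprime_commute)
  also have "real b' * (z / real b) = z / real q"
    using b' by (simp add: bc(1))
  finally show ?thesis
    by (simp add: bc(1) mult_ac)
qed

lemma sum_bernoulli_fun_shifted:
  assumes b: "b > 0" and p: "p > 1"
  shows "real b ^ p * (\<Sum>l<b. bernoulli_fun p (u + (y + real l) / real b)) =
           real b * bernoulli_fun p (real b * u + y)"
  using bernoulli_fun_multiplication[OF b, of 1 p "u + y / real b"] b p
  by (simp add: add_divide_distrib add_ac distrib_left)

text \<open>
  The shifts are taken in the open unit interval, so that no argument of the first-order function is
  an integer and the polynomials on the right need no reduction modulo 1.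
\<close>

theorem shifted_dedekind_sum_reciprocity:
  fixes b c p :: nat and x y :: real
  assumes b: "b > 0" and c: "c > 0" and p: "p > 1"
    and x: "0 < x" "x < 1" and y: "0 < y" "y < 1"
  defines "q \<equiv> gcd b c"
  shows "real (p + 1) * (real b * real c ^ p * shifted_dedekind_sum p b c x y +
                         real c * real b ^ p * shifted_dedekind_sum p c b y x) =
     (\<Sum>j=0..p+1. real ((p + 1) choose j) * real b ^ j * real c ^ (p + 1 - j) *
        bernoulli_poly j x * bernoulli_poly (p + 1 - j) y) +
     real p * real q ^ (p + 1) * bernoulli_fun (p + 1) ((real b * x + real c * y) / real q)"
proof -
  let ?u = "\<lambda>m. (x + real m) / real c" and ?v = "\<lambda>l. (y + real l) / real b"
  let ?B = bernoulli_fun and ?K = "real b ^ (p + 1) * real c ^ (p + 1)"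
  have unit: "0 < (t + real m) / real n \<and> (t + real m) / real n < 1"
    if "0 < t" "t < 1" "m < n" for t m n
  proof -
    have "real m + 1 \<le> real n" using that by simp
    thus ?thesis using that by (simp add: field_simps)
  qed
  \<comment> \<open>The four double sums that arise from the pointwise identity.  The factor \<open>?K\<close> clears all
    denominators and leaves \<open>b c\<close> times the terms of the reciprocity law.\<close>
  have S1: "?K * (\<Sum>m<c. \<Sum>l<b. ?B p (?u m + ?v l) * ?B 1 (?u m)) =
          real b * real c * (real b * real c ^ p * shifted_dedekind_sum p b c x y)"
  proof -
    have "?K * (\<Sum>m<c. \<Sum>l<b. ?B p (?u m + ?v l) * ?B 1 (?u m)) =
        real b * real c ^ (p + 1) *
          (\<Sum>m<c. real b ^ p * (\<Sum>l<b. ?B p (?u m + ?v l)) * ?B 1 (?u m))"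
      by (simp add: sum_distrib_left sum_distrib_right mult_ac)
    thus ?thesis
      unfolding sum_bernoulli_fun_shifted[OF b p] shifted_dedekind_sum_def
      by (simp add: sum_distrib_left mult_ac)
  qed
  have S2: "?K * (\<Sum>m<c. \<Sum>l<b. ?B p (?u m + ?v l) * ?B 1 (?v l)) =
          real b * real c * (real c * real b ^ p * shifted_dedekind_sum p c b y x)"
  proof -
    have "?K * (\<Sum>m<c. \<Sum>l<b. ?B p (?u m + ?v l) * ?B 1 (?v l)) =
        real c * real b ^ (p + 1) *
          (\<Sum>l<b. real c ^ p * (\<Sum>m<c. ?B p (?v l + ?u m)) * ?B 1 (?v l))"
      by (subst sum.swap) (simp add: sum_distrib_left sum_distrib_right mult_ac add.commute)
    thus ?thesis
      unfolding sum_bernoulli_fun_shifted[OF c p] shifted_dedekind_sum_def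
      by (simp add: sum_distrib_left mult_ac)
  qed
  have S3: "?K * (\<Sum>m<c. \<Sum>l<b. ?B (p + 1) (?u m + ?v l)) =
          real b * real c * (real q ^ (p + 1) * ?B (p + 1) ((real b * x + real c * y) / real q))"
  proof -
    have "?u m + ?v l =
        (real b * x + real c * y) / (real b * real c) + real m / real c + real l / real b" for m l
      using b c by (simp add: field_simps)
    thus ?thesis
      using bernoulli_fun_sum_two_progressions[OF b c, of "p + 1" "real b * x + real c * y"] p
      by (simp add: q_def mult_ac)
  qed
  let ?P = "\<lambda>j. real ((p + 1) choose j)"
  have S4: "?K * (\<Sum>m<c. \<Sum>l<b. \<Sum>j=0..p+1.
              ?P j * bernoulli_poly j (?u m) * bernoulli_poly (p + 1 - j) (?v l)) =
          real b * real c * (\<Sum>j=0..p+1. ?P j * real b ^ j * real c ^ (p + 1 - j) *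
            bernoulli_poly j x * bernoulli_poly (p + 1 - j) y)"
  proof -
    have mul: "real n ^ j * (\<Sum>l<n. bernoulli_poly j ((t + real l) / real n)) =
                 real n * bernoulli_poly j t" if "n > 0" for n j t
      using bernoulli_poly_multiplication[OF that, of j "t / real n"] that
      by (simp add: add_divide_distrib)
    have "(\<Sum>m<c. \<Sum>l<b. \<Sum>j=0..p+1.
              ?P j * bernoulli_poly j (?u m) * bernoulli_poly (p + 1 - j) (?v l)) =
        (\<Sum>m<c. \<Sum>j=0..p+1. \<Sum>l<b.
              ?P j * bernoulli_poly j (?u m) * bernoulli_poly (p + 1 - j) (?v l))"
      by (intro sum.cong refl sum.swap)
    also have "\<dots> = (\<Sum>j=0..p+1. \<Sum>m<c. \<Sum>l<b.
              ?P j * bernoulli_poly j (?u m) * bernoulli_poly (p + 1 - j) (?v l))"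
      by (rule sum.swap)
    also have "\<dots> = (\<Sum>j=0..p+1. ?P j * ((\<Sum>m<c. bernoulli_poly j (?u m)) *
                                           (\<Sum>l<b. bernoulli_poly (p + 1 - j) (?v l))))"
      by (simp only: sum_product) (simp only: sum_distrib_left mult.assoc)
    finally have "?K * (\<Sum>m<c. \<Sum>l<b. \<Sum>j=0..p+1.
              ?P j * bernoulli_poly j (?u m) * bernoulli_poly (p + 1 - j) (?v l)) =
      (\<Sum>j=0..p+1. ?K * (?P j * ((\<Sum>m<c. bernoulli_poly j (?u m)) *
                                           (\<Sum>l<b. bernoulli_poly (p + 1 - j) (?v l)))))"
      by (simp only: sum_distrib_left)
    also have "\<dots> = (\<Sum>j=0..p+1. ?P j * real b ^ j * real c ^ (p + 1 - j) *
        (real c ^ j * (\<Sum>m<c. bernoulli_poly j (?u m))) *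
        (real b ^ (p + 1 - j) * (\<Sum>l<b. bernoulli_poly (p + 1 - j) (?v l))))"
    proof (intro sum.cong refl)
      fix j assume "j \<in> {0..p+1}"
      hence split: "r ^ (p + 1) = r ^ j * r ^ (p + 1 - j)" for r :: real
        by (simp flip: power_add)
      have "?K = real b ^ j * real c ^ (p + 1 - j) * real c ^ j * real b ^ (p + 1 - j)"
        by (simp only: split[of "real b"] split[of "real c"] mult_ac)
      thus "?K * (?P j * ((\<Sum>m<c. bernoulli_poly j (?u m)) *
               (\<Sum>l<b. bernoulli_poly (p + 1 - j) (?v l)))) =
          ?P j * real b ^ j * real c ^ (p + 1 - j) *
        (real c ^ j * (\<Sum>m<c. bernoulli_poly j (?u m))) *
        (real b ^ (p + 1 - j) * (\<Sum>l<b. bernoulli_poly (p + 1 - j) (?v l)))"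
        by (simp only: mult_ac)
    qed
    also have "\<dots> = real b * real c * (\<Sum>j=0..p+1. ?P j * real b ^ j * real c ^ (p + 1 - j) *
            bernoulli_poly j x * bernoulli_poly (p + 1 - j) y)"
      unfolding mul[OF b] mul[OF c] unfolding sum_distrib_left
      by (intro sum.cong refl) (simp only: mult_ac)
    finally show ?thesis .
  qed
  have "?K * (\<Sum>m<c. \<Sum>l<b. real (p + 1) * (?B p (?u m + ?v l) * (?B 1 (?u m) + ?B 1 (?v l)))) =
        ?K * (\<Sum>m<c. \<Sum>l<b. (\<Sum>j=0..p+1.
              ?P j * bernoulli_poly j (?u m) * bernoulli_poly (p + 1 - j) (?v l))
            + real p * ?B (p + 1) (?u m + ?v l))"
    using unit[OF x] unit[OF y]
    by (intro arg_cong2[where f = "(*)"] sum.cong refl bernoulli_fun_convolution p) simp_all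
  hence "real (p + 1) * (?K * (\<Sum>m<c. \<Sum>l<b. ?B p (?u m + ?v l) * ?B 1 (?u m)) +
                         ?K * (\<Sum>m<c. \<Sum>l<b. ?B p (?u m + ?v l) * ?B 1 (?v l))) =
      ?K * (\<Sum>m<c. \<Sum>l<b. \<Sum>j=0..p+1.
              ?P j * bernoulli_poly j (?u m) * bernoulli_poly (p + 1 - j) (?v l)) +
      real p * (?K * (\<Sum>m<c. \<Sum>l<b. ?B (p + 1) (?u m + ?v l)))"
    by (simp only: sum.distrib sum_distrib_left[symmetric] distrib_left mult.left_commute)
  hence "(real b * real c) * (real (p + 1) * (real b * real c ^ p * shifted_dedekind_sum p b c x y +
                         real c * real b ^ p * shifted_dedekind_sum p c b y x)) =
     (real b * real c) * ((\<Sum>j=0..p+1. ?P j * real b ^ j * real c ^ (p + 1 - j) *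
        bernoulli_poly j x * bernoulli_poly (p + 1 - j) y) +
     real p * real q ^ (p + 1) * ?B (p + 1) ((real b * x + real c * y) / real q))"
    unfolding S1 S2 S3 S4 by (simp only: distrib_left mult_ac)
  moreover have "real b * real c \<noteq> 0"
    using b c by simp
  ultimately show ?thesis
    by (rule mult_left_cancel[THEN iffD1, rotated])
qed

section \<open>Reduction of character sums to shifted sums\<close>

text \<open>
  A character that does not vanish at 0 has modulus 1, where every character is principal.
\<close>

lemma nonprincipal_character_zero:
  assumes chi: "dirichlet_character k chi" and np: "chi \<noteq> principal_character k"
  shows "chi 0 = 0"
proof (rule ccontr)
  assume "chi 0 \<noteq> 0"
  hence "chi a * chi 0 = chi 0" for a
    using chi unfolding dirichlet_character_def by (metis mult_zero_right)
  hence "chi a = 1" for a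
    using \<open>chi 0 \<noteq> 0\<close> by simp
  moreover have "k = 1"
    using chi \<open>chi 0 \<noteq> 0\<close> by (auto simp: dirichlet_character_def)
  ultimately have "chi = principal_character k"
    by (auto simp: principal_character_def)
  thus False using np by contradiction
qed

lemma dirichlet_character_add_mult:
  assumes "dirichlet_character k chi"
  shows "chi (a + int k * int m) = chi a"
proof (induction m)
  case (Suc m)
  have "chi (a + int k * int (Suc m)) = chi ((a + int k * int m) + int k)"
    by (simp add: algebra_simps)
  thus ?case using assms Suc by (simp add: dirichlet_character_def)
qed simp

lemma sum_lessThan_eq_from_one:
  fixes f :: "nat \<Rightarrow> 'a::comm_monoid_add"
  assumes "k > 0" "f 0 = 0"
  shows "(\<Sum>n<k. f n) = (\<Sum>n=1..k-1. f n)"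
proof -
  have "{..<k} = insert 0 {1..k-1}" using assms by auto
  thus ?thesis using assms by simp
qed

text \<open>
  The expression of generalized Bernoulli numbers by values of Bernoulli polynomials.  The factor
  \<open>k\<close> on the left avoids the exponent \<open>n - 1\<close>, which would be truncated at \<open>n = 0\<close>.
\<close>

lemma gen_bernoulli_num_eq:
  assumes k: "k > 0"
  shows "of_nat k * gen_bernoulli_num k chi n =
    of_nat k ^ n * (\<Sum>a<k. cnj (chi (int a)) * of_real (bernoulli_poly n (real a / real k)))"
proof -
  let ?E = "fps_exp (of_nat k :: complex) - 1"
  have nz: "?E \<noteq> 0"
    using k by (intro fps_exp_minus_one_nonzero) simp
  have coeff: "of_nat k * fps_nth (fps_const (cnj (chi (int a))) * fps_X * fps_exp (of_nat a + 0) / ?E) n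
     = cnj (chi (int a)) * of_nat k ^ n * fps_nth (bernoulli_fps (of_nat a / of_nat k)) n" for a
  proof -
    let ?F = "fps_const (cnj (chi (int a))) * fps_X * fps_exp (of_nat a + 0) / ?E"
    let ?G = "bernoulli_fps (of_nat a / of_nat k) oo (fps_const (of_nat k) * fps_X)"
    have "fps_const (of_nat k) * ?F * ?E = fps_const (cnj (chi (int a))) * ?G * ?E"
      using k unfolding mult.assoc bernoulli_fps_compose_linear
      by (subst fps_X_exp_divide_times[unfolded mult.assoc]) (simp_all add: mult_ac)
    hence "fps_const (of_nat k) * ?F = fps_const (cnj (chi (int a))) * ?G"
      using nz by (metis mult_right_cancel)
    hence "fps_nth (fps_const (of_nat k) * ?F) n = fps_nth (fps_const (cnj (chi (int a))) * ?G) n"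
      by (rule arg_cong)
    thus ?thesis
      by (simp add: mult.assoc)
  qed
  have "of_nat k * gen_bernoulli_num k chi n = fact n * (\<Sum>a<k.
      of_nat k * fps_nth (fps_const (cnj (chi (int a))) * fps_X * fps_exp (of_nat a + 0) / ?E) n)"
    by (simp add: gen_bernoulli_num_def gen_bernoulli_poly_def fps_sum_nth sum_distrib_left mult_ac)
  also have "\<dots> = of_nat k ^ n * (\<Sum>a<k. cnj (chi (int a)) * bernoulli_poly n (of_nat a / of_nat k))"
    unfolding coeff by (simp add: bernoulli_poly_eq_fps_nth sum_distrib_left mult_ac)
  finally show ?thesis
    by (simp add: of_real_bernoulli_poly)
qed

lemma char_dedekind_sum_eq:
  assumes chi: "dirichlet_character k chi\<^sub>1" and zero: "chi\<^sub>1 0 = 0" and c: "c > 0"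
  shows "char_dedekind_sum k p b c chi\<^sub>1 chi\<^sub>2 = of_nat k ^ (p - 1) *
     (\<Sum>h=1..k-1. \<Sum>a=1..k-1. chi\<^sub>1 (int h) * cnj (chi\<^sub>2 (int a)) *
        of_real (shifted_dedekind_sum p b c (real h / real k) (real a / real k)))"
proof -
  have k: "k > 0"
    using chi by (simp add: dirichlet_character_def)
  let ?t = "\<lambda>n. chi\<^sub>1 (int n) * gen_bernoulli_fun k chi\<^sub>2 p (real b * real n / real c) *
                of_real (bernoulli_fun 1 (real n / (real c * real k)))"
  let ?B = "\<lambda>h a m. bernoulli_fun p (real b * ((real h / real k + real m) / real c) + real a / real k) *
                     bernoulli_fun 1 ((real h / real k + real m) / real c)"
  have t: "?t (m * k + h) = of_nat k ^ (p - 1) *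
     (\<Sum>a=1..k-1. chi\<^sub>1 (int h) * cnj (chi\<^sub>2 (int a)) * of_real (?B h a m))" for m h
  proof -
    have 1: "chi\<^sub>1 (int (m * k + h)) = chi\<^sub>1 (int h)"
      using dirichlet_character_add_mult[OF chi, of "int h" m] by (simp add: algebra_simps)
    have 2: "(real a + real b * real (m * k + h) / real c) / real k =
          real b * ((real h / real k + real m) / real c) + real a / real k" for a
      using k c by (simp add: field_simps)
    have 3: "real (m * k + h) / (real c * real k) = (real h / real k + real m) / real c"
      using k c by (simp add: field_simps)
    show ?thesis
      unfolding gen_bernoulli_fun_def 1 2 3
      by (simp add: sum_distrib_left sum_distrib_right mult_ac)
  qed
  have "char_dedekind_sum k p b c chi\<^sub>1 chi\<^sub>2 = (\<Sum>m<c. \<Sum>n\<in>{m * k..<m * k + k}. ?t n)"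
    by (simp only: char_dedekind_sum_def sum.nat_group)
  also have "\<dots> = (\<Sum>m<c. \<Sum>h<k. ?t (m * k + h))"
  proof (rule sum.cong[OF refl])
    fix m
    show "(\<Sum>n\<in>{m * k..<m * k + k}. ?t n) = (\<Sum>h<k. ?t (m * k + h))"
      using sum.shift_bounds_nat_ivl[of ?t 0 "m * k" k]
      by (simp only: add_0 lessThan_atLeast0 add.commute)
  qed
  also have "\<dots> = (\<Sum>h<k. \<Sum>m<c. ?t (m * k + h))"
    by (rule sum.swap)
  also have "\<dots> = (\<Sum>h=1..k-1. \<Sum>m<c. ?t (m * k + h))"
    by (rule sum_lessThan_eq_from_one[OF k]) (simp only: t, simp add: zero)
  also have "\<dots> = of_nat k ^ (p - 1) * (\<Sum>h=1..k-1. \<Sum>m<c.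
     \<Sum>a=1..k-1. chi\<^sub>1 (int h) * cnj (chi\<^sub>2 (int a)) * of_real (?B h a m))"
    by (simp only: t sum_distrib_left)
  also have "(\<Sum>h=1..k-1. \<Sum>m<c.
       \<Sum>a=1..k-1. chi\<^sub>1 (int h) * cnj (chi\<^sub>2 (int a)) * of_real (?B h a m)) =
     (\<Sum>h=1..k-1. \<Sum>a=1..k-1. \<Sum>m<c.
       chi\<^sub>1 (int h) * cnj (chi\<^sub>2 (int a)) * of_real (?B h a m))"
    by (intro sum.cong refl sum.swap)
  finally show ?thesis
    by (simp only: shifted_dedekind_sum_def of_real_sum sum_distrib_left)
qed

theorem theorem1:
  fixes b c p k q :: nat and chi\<^sub>1 chi\<^sub>2 :: "int \<Rightarrow> complex"
  assumes "b > 0" and "c > 0" and "q = gcd b c" and "p > 1"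
    and "primitive_character k chi\<^sub>1" and "chi\<^sub>1 \<noteq> principal_character k"
    and "primitive_character k chi\<^sub>2" and "chi\<^sub>2 \<noteq> principal_character k"
    and "(-1) ^ (p + 1) * chi\<^sub>1 (-1) * chi\<^sub>2 (-1) = 1"
  shows "of_nat (p + 1) *
           (of_nat b * of_nat c ^ p * char_dedekind_sum k p b c chi\<^sub>1 chi\<^sub>2 +
            of_nat c * of_nat b ^ p * char_dedekind_sum k p c b (cnj \<circ> chi\<^sub>2) (cnj \<circ> chi\<^sub>1)) =
         (\<Sum>j=0..p+1. of_nat ((p + 1) choose j) * of_nat b ^ j * of_nat c ^ (p + 1 - j) *
            gen_bernoulli_num k (cnj \<circ> chi\<^sub>1) j * gen_bernoulli_num k chi\<^sub>2 (p + 1 - j)) +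
         of_nat p * of_nat q ^ (p + 1) * of_nat k ^ (p - 1) *
           (\<Sum>h=1..k-1. \<Sum>a=1..k-1. chi\<^sub>1 (int h) * cnj (chi\<^sub>2 (int a)) *
              of_real (bernoulli_fun (p + 1)
                ((real c * real a + real b * real h) / (real q * real k))))"
proof -
  have chi: "dirichlet_character k chi\<^sub>1" "dirichlet_character k chi\<^sub>2"
    using assms by (simp_all add: primitive_character_def)
  have zero: "chi\<^sub>1 0 = 0" "chi\<^sub>2 0 = 0"
    using nonprincipal_character_zero chi assms by blast+
  have k: "k > 0"
    using chi by (simp add: dirichlet_character_def)
  let ?w = "\<lambda>h a. chi\<^sub>1 (int h) * cnj (chi\<^sub>2 (int a))"
  \<comment> \<open>\<open>W\<close> sums a function of \<open>h\<close> and \<open>a\<close> against the characters, scaled by \<open>k\<^sup>p\<^sup>-\<^sup>1\<close>; each term of the claim is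
    \<open>W\<close> of the corresponding term of the reciprocity law for the shifts \<open>h/k\<close> and \<open>a/k\<close>.\<close>
  define W where "W = (\<lambda>f :: nat \<Rightarrow> nat \<Rightarrow> real. of_nat k ^ (p - 1) *
      (\<Sum>h=1..k-1. \<Sum>a=1..k-1. ?w h a * complex_of_real (f h a)))"
  have W_add: "W (\<lambda>h a. f h a + g h a) = W f + W g" for f g
    by (simp add: W_def distrib_left sum.distrib)
  have W_scale: "W (\<lambda>h a. r * f h a) = of_real r * W f" for r f
    by (simp add: W_def sum_distrib_left mult_ac)
  have W_sum: "W (\<lambda>h a. \<Sum>j=0..n. f j h a) = (\<Sum>j=0..n. W (f j))" for f and n :: nat
    by (induction n) (simp_all add: W_add)
  have S1: "char_dedekind_sum k p b c chi\<^sub>1 chi\<^sub>2 =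
      W (\<lambda>h a. shifted_dedekind_sum p b c (real h / real k) (real a / real k))"
    by (simp add: char_dedekind_sum_eq chi zero assms W_def)
  have "dirichlet_character k (cnj \<circ> chi\<^sub>2)" "(cnj \<circ> chi\<^sub>2) 0 = 0"
    using chi zero by (simp_all add: dirichlet_character_def)
  hence "char_dedekind_sum k p c b (cnj \<circ> chi\<^sub>2) (cnj \<circ> chi\<^sub>1) = of_nat k ^ (p - 1) *
      (\<Sum>a=1..k-1. \<Sum>h=1..k-1. cnj (chi\<^sub>2 (int a)) * chi\<^sub>1 (int h) *
        of_real (shifted_dedekind_sum p c b (real a / real k) (real h / real k)))"
    by (simp add: char_dedekind_sum_eq assms)
  hence S2: "char_dedekind_sum k p c b (cnj \<circ> chi\<^sub>2) (cnj \<circ> chi\<^sub>1) =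
      W (\<lambda>h a. shifted_dedekind_sum p c b (real a / real k) (real h / real k))"
    unfolding W_def by (subst sum.swap) (simp only: mult.commute)
  have S3: "gen_bernoulli_num k (cnj \<circ> chi\<^sub>1) j * gen_bernoulli_num k chi\<^sub>2 (p + 1 - j) =
      W (\<lambda>h a. bernoulli_poly j (real h / real k) * bernoulli_poly (p + 1 - j) (real a / real k))"
    (is "?G1 * ?G2 = W ?f") if "j \<le> p + 1" for j
  proof -
    let ?K = "of_nat k :: complex"
    have "(?K * ?G1) * (?K * ?G2) = (?K ^ j * ?K ^ (p + 1 - j)) *
       ((\<Sum>h<k. chi\<^sub>1 (int h) * of_real (bernoulli_poly j (real h / real k))) *
        (\<Sum>a<k. cnj (chi\<^sub>2 (int a)) * of_real (bernoulli_poly (p + 1 - j) (real a / real k))))"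
      unfolding gen_bernoulli_num_eq[OF k] by (simp add: mult_ac)
    also have "?K ^ j * ?K ^ (p + 1 - j) = ?K ^ (p + 1)"
      using that by (simp flip: power_add)
    also have "?K ^ (p + 1) = ?K * ?K * ?K ^ (p - 1)"
      using assms(4) by (cases p) simp_all
    also have "(\<Sum>h<k. chi\<^sub>1 (int h) * of_real (bernoulli_poly j (real h / real k))) =
        (\<Sum>h=1..k-1. chi\<^sub>1 (int h) * of_real (bernoulli_poly j (real h / real k)))"
      by (rule sum_lessThan_eq_from_one[OF k]) (simp add: zero)
    also have "(\<Sum>a<k. cnj (chi\<^sub>2 (int a)) * of_real (bernoulli_poly (p + 1 - j) (real a / real k))) =
        (\<Sum>a=1..k-1. cnj (chi\<^sub>2 (int a)) * of_real (bernoulli_poly (p + 1 - j) (real a / real k)))"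
      by (rule sum_lessThan_eq_from_one[OF k]) (simp add: zero)
    finally have "(?K * ?K) * (?G1 * ?G2) = (?K * ?K) * W ?f"
      by (simp add: W_def sum_product mult_ac comp_def)
    thus ?thesis using k by simp
  qed
  let ?x = "\<lambda>h. real h / real k"
  let ?R = "\<lambda>h a. (\<Sum>j=0..p+1. (real ((p + 1) choose j) * real b ^ j * real c ^ (p + 1 - j)) *
        (bernoulli_poly j (?x h) * bernoulli_poly (p + 1 - j) (?x a))) +
     (real p * real q ^ (p + 1)) *
       bernoulli_fun (p + 1) ((real c * real a + real b * real h) / (real q * real k))"
  have "W (\<lambda>h a. real (p + 1) * ((real b * real c ^ p) * shifted_dedekind_sum p b c (?x h) (?x a) +
                  (real c * real b ^ p) * shifted_dedekind_sum p c b (?x a) (?x h))) = W ?R"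
  proof -
    have "real (p + 1) * ((real b * real c ^ p) * shifted_dedekind_sum p b c (?x h) (?x a) +
         (real c * real b ^ p) * shifted_dedekind_sum p c b (?x a) (?x h)) = ?R h a"
      if "h \<in> {1..k-1}" "a \<in> {1..k-1}" for h a
    proof -
      have "(real b * ?x h + real c * ?x a) / real q =
              (real c * real a + real b * real h) / (real q * real k)"
        using k by (simp add: field_simps)
      moreover have "0 < ?x h" "?x h < 1" "0 < ?x a" "?x a < 1"
        using that k by auto
      ultimately show ?thesis
        using shifted_dedekind_sum_reciprocity[OF assms(1,2,4), of "?x h" "?x a"] assms(3)
        by (simp only: mult.assoc)
    qed
    thus ?thesis
      unfolding W_def by (intro arg_cong2[where f = "(*)"] sum.cong refl) simp_all
  qed
  hence "of_nat (p + 1) *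
           (of_nat b * of_nat c ^ p * char_dedekind_sum k p b c chi\<^sub>1 chi\<^sub>2 +
            of_nat c * of_nat b ^ p * char_dedekind_sum k p c b (cnj \<circ> chi\<^sub>2) (cnj \<circ> chi\<^sub>1)) =
       (\<Sum>j=0..p+1. of_nat ((p + 1) choose j) * of_nat b ^ j * of_nat c ^ (p + 1 - j) *
         W (\<lambda>h a. bernoulli_poly j (?x h) * bernoulli_poly (p + 1 - j) (?x a))) +
       of_nat p * of_nat q ^ (p + 1) *
         W (\<lambda>h a. bernoulli_fun (p + 1) ((real c * real a + real b * real h) / (real q * real k)))"
    unfolding S1 S2 W_add W_scale W_sum
    by (simp only: of_real_mult of_real_power of_real_of_nat_eq)
  also have "(\<Sum>j=0..p+1. of_nat ((p + 1) choose j) * of_nat b ^ j * of_nat c ^ (p + 1 - j) *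
         W (\<lambda>h a. bernoulli_poly j (?x h) * bernoulli_poly (p + 1 - j) (?x a))) =
      (\<Sum>j=0..p+1. of_nat ((p + 1) choose j) * of_nat b ^ j * of_nat c ^ (p + 1 - j) *
            gen_bernoulli_num k (cnj \<circ> chi\<^sub>1) j * gen_bernoulli_num k chi\<^sub>2 (p + 1 - j))"
  proof (rule sum.cong[OF refl])
    fix j assume "j \<in> {0..p+1}"
    thus "of_nat ((p + 1) choose j) * of_nat b ^ j * of_nat c ^ (p + 1 - j) *
         W (\<lambda>h a. bernoulli_poly j (?x h) * bernoulli_poly (p + 1 - j) (?x a)) =
        of_nat ((p + 1) choose j) * of_nat b ^ j * of_nat c ^ (p + 1 - j) *
            gen_bernoulli_num k (cnj \<circ> chi\<^sub>1) j * gen_bernoulli_num k chi\<^sub>2 (p + 1 - j)"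
      using S3[of j] by simp
  qed
  finally show ?thesis
    unfolding W_def mult.assoc .
qed

end
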